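(* Let $\omega=(\omega_1,\omega_2,\omega_3)\in\mathbb R^3$ be a $B$ irrational direction, i.e. $\omega_1,\omega_2,\omega_3$ are linearly independent over $\mathbb Q$ and $\omega_1^{-1},\omega_2^{-1},\omega_3^{-1}$ are linearly independent over $\mathbb Q$. Then the directional billiard complexity in the cube, for the coding with three letters in which parallel faces receive the same letter, satisfies $$p(n,\omega)=n^{2}+n+1\qquad\text{for all } n>0.$$
   Context: Billiard in the cube: a point mass moves inside the cube (with edges parallel to the coordinate axes) with unit speed along a straight line until it reaches the boundary, then its direction changes according to the mirror law (reflection in the face that is hit), and it continues along the new line. Coding and complexity: each face of the cube is labelled with a letter, parallel faces being given the same letter (so three letters are used). The orbit of a point with initial direction $\omega$ is coded by the sequence of labels of the faces it hits (orbits hitting edges are excluded). $\mathcal L(n,\omega)$ is the set of all words of length $n$ arising from orbits with initial direction $\omega$, and $p(n,\omega)=\mathrm{card}(\mathcal L(n,\omega))$. *)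

theory Defs
  imports "HOL-Analysis.Analysis"
begin

text \<open>
  Linear independence over the rationals of the three components as an indexed family
  (a formulation via the set of components would not exclude repeated values).
\<close>

definition rationally_independent :: "real^3 \<Rightarrow> bool" where
  "rationally_independent x \<longleftrightarrow>
     (\<forall>a :: 3 \<Rightarrow> rat. (\<Sum>i\<in>UNIV. of_rat (a i) * x $ i) = 0 \<longrightarrow> (\<forall>i. a i = 0))"

definition B_irrational :: "real^3 \<Rightarrow> bool" where
  "B_irrational \<omega> \<longleftrightarrow>
     rationally_independent \<omega> \<and> rationally_independent (\<chi> i. inverse (\<omega> $ i))"

definition unit_cube :: "(real^3) set" where
  "unit_cube = cbox 0 1"

text \<open>
  The faces are \<open>cube_face i 0\<close> and \<open>cube_face i 1\<close>. The letter of a face is the index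
  \<open>i\<close> of the coordinate axis orthogonal to it, so exactly the parallel faces share a letter.
\<close>

definition cube_face :: "3 \<Rightarrow> real \<Rightarrow> (real^3) set" where
  "cube_face i c = {x \<in> unit_cube. x $ i = c}"

definition cube_edges :: "(real^3) set" where
  "cube_edges = {x. \<exists>i j. i \<noteq> j \<and> x \<in> (cube_face i 0 \<union> cube_face i 1) \<inter> (cube_face j 0 \<union> cube_face j 1)}"

definition reflect :: "3 \<Rightarrow> real^3 \<Rightarrow> real^3" where
  "reflect i v = (\<chi> j. if j = i then - v $ j else v $ j)"

text \<open>
  Moving from \<open>x\<close> with velocity \<open>v\<close>, the point first reaches the boundary at \<open>y\<close>,
  which lies on a face with letter \<open>i\<close> and not on an edge.
\<close>

definition hits_face :: "real^3 \<Rightarrow> real^3 \<Rightarrow> real^3 \<Rightarrow> 3 \<Rightarrow> bool" where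
  "hits_face x v y i \<longleftrightarrow>
     (\<exists>t>0. y = x + t *\<^sub>R v) \<and>
     open_segment x y \<subseteq> interior unit_cube \<and>
     y \<in> (cube_face i 0 \<union> cube_face i 1) - cube_edges"

text \<open>
  \<open>billiard_coding \<omega> w\<close>: the sequence \<open>w\<close> codes an orbit that starts inside the cube
  with direction \<open>\<omega>\<close> and unit speed (\<open>sgn \<omega>\<close> is the normalised vector) and never hits an edge.
  Here \<open>q 0\<close> is the initial position, \<open>q (Suc k)\<close> is the point of the \<open>k\<close>-th collision
  (counted from 0) and \<open>v k\<close> is the velocity just before that collision.
\<close>

definition billiard_coding :: "real^3 \<Rightarrow> (nat \<Rightarrow> 3) \<Rightarrow> bool" where
  "billiard_coding \<omega> w \<longleftrightarrow>
     (\<exists>q v. q 0 \<in> interior unit_cube \<and> v 0 = sgn \<omega> \<and>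
        (\<forall>k. hits_face (q k) (v k) (q (Suc k)) (w k) \<and> v (Suc k) = reflect (w k) (v k)))"

definition billiard_language :: "nat \<Rightarrow> real^3 \<Rightarrow> 3 list set" where
  "billiard_language n \<omega> = {map w [k..<k + n] | w k. billiard_coding \<omega> w}"

definition billiard_complexity :: "nat \<Rightarrow> real^3 \<Rightarrow> nat" where
  "billiard_complexity n \<omega> = card (billiard_language n \<omega>)"

end

theory Submission
  imports Defs
begin

text \<open>
  Unfolding the billiard turns an orbit into a line, and the letter \<open>i\<close> into the events of an
  arithmetic progression of times with period \<open>a $ i\<close> proportional to \<open>1 / \<bar>\<omega> $ i\<bar>\<close>; a word records
  the order in which three such progressions with arbitrary phases are merged. For a word \<open>w\<close> the
  phases (modulo a common shift) coding \<open>w\<close> form an open convex subset of a plane, and its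
  left extensions correspond to the parts into which a tripod cuts this set. By Euler's formula,
  \<open>p (n + 1) - p n\<close> is the number of words of length \<open>n\<close> starting from the edges, summed over the
  three kinds of edges, minus the single word starting from a vertex. The words starting
  from an edge form a family with one parameter. When \<open>n\<close> grows by one, this family gains a word exactly if letter \<open>n + 1\<close> of the vertex
  word is one of the two letters meeting at that edge, so \<open>p (n + 1) - p n = (2 n + 3) - 1\<close>.
\<close>

subsection \<open>Convex sets cut by a tripod\<close>

lemma UNIV_3_distinct:
  fixes i j k :: 3
  assumes "i \<noteq> j" "i \<noteq> k" "j \<noteq> k"
  shows "UNIV = {i, j, k}"
proof -
  have "card {i, j, k} = CARD(3)" using assms by simp
  then show ?thesis by (metis card_subset_eq finite subset_UNIV)
qed

lemma obtain_third_3: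
  fixes i j :: 3
  assumes "i \<noteq> j"
  obtains k where "k \<noteq> i" "k \<noteq> j" "UNIV = {i, j, k}"
proof -
  have "card {i, j} < CARD(3)" using assms by simp
  then have "{i, j} \<noteq> UNIV" by (metis less_irrefl)
  then obtain k where "k \<notin> {i, j}" by auto
  then show ?thesis using that[of k] UNIV_3_distinct[of i j k] assms by auto
qed

lemma exists_3: "(\<exists>i::3. P i) \<longleftrightarrow> P 1 \<or> P 2 \<or> P 3"
  by (metis exhaust_3)

lemma open_ray:
  fixes U :: "('a::real_normed_vector) set"
  assumes "open U" "z \<in> U"
  obtains e where "e > 0" "\<And>t. \<bar>t\<bar> \<le> e \<Longrightarrow> z + t *\<^sub>R d \<in> U"
proof -
  have "open ((\<lambda>t. z + t *\<^sub>R d) -` U)"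
    by (rule open_vimage[OF assms(1)]) (intro continuous_intros)
  moreover have "0 \<in> (\<lambda>t. z + t *\<^sub>R d) -` U" using assms(2) by simp
  ultimately obtain e where e: "e > 0" "cball 0 e \<subseteq> (\<lambda>t. z + t *\<^sub>R d) -` U"
    by (meson open_contains_cball)
  show ?thesis
  proof
    show "e > 0" by fact
    show "z + t *\<^sub>R d \<in> U" if "\<bar>t\<bar> \<le> e" for t :: real
      using e(2) that by (auto simp: subset_iff)
  qed
qed

text \<open>
  This is Euler's formula for the tripod that cuts the plane \<open>real^3 / (1,1,1)\<close> into the three
  regions where a given coordinate is the largest.
\<close>

lemma tripod_count:
  fixes U :: "(real^3) set"
  assumes U: "open U" "convex U" "U \<noteq> {}"
  defines "E i \<equiv> \<exists>z\<in>U. \<forall>j. j \<noteq> i \<longrightarrow> z$j < z$i"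
    and "V k \<equiv> \<exists>z\<in>U. \<exists>c. z$k < c \<and> (\<forall>i. i \<noteq> k \<longrightarrow> z$i = c)"
    and "T \<equiv> \<exists>z\<in>U. \<exists>c. \<forall>i. z$i = c"
  shows "int (card {i. E i}) = 1 + (\<Sum>k\<in>UNIV. of_bool (V k)) - of_bool T"
proof -
  \<comment> \<open>The strata of the tripod are its centre \<open>T\<close>, its legs
    \<open>V k\<close> and its open regions \<open>E i\<close>. A small move inside the open set
    \<open>U\<close> leads to a larger stratum: lower coordinate \<open>k\<close> at the centre, or
    raise coordinate \<open>i\<close> on a leg.\<close>
  have TV: "V k" if T for k
  proof -
    obtain z c where z: "z \<in> U" "\<And>i. z$i = c" using \<open>T\<close> unfolding T_def by auto
    obtain e where e: "e > 0" "\<And>t. \<bar>t\<bar> \<le> e \<Longrightarrow> z + t *\<^sub>R axis k (1::real) \<in> U"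
      using open_ray[OF U(1) z(1), of "axis k 1"] by blast
    show ?thesis unfolding V_def
      by (rule bexI[OF _ e(2)[of "-e"]], rule exI[of _ c]) (use e(1) z in \<open>auto simp: axis_def\<close>)
  qed
  have VE: "E i" if "V k" "i \<noteq> k" for i k
  proof -
    obtain z c where z: "z \<in> U" "z$k < c" "\<And>i. i \<noteq> k \<Longrightarrow> z$i = c"
      using \<open>V k\<close> unfolding V_def by auto
    obtain e where e: "e > 0" "\<And>t. \<bar>t\<bar> \<le> e \<Longrightarrow> z + t *\<^sub>R axis i (1::real) \<in> U"
      using open_ray[OF U(1) z(1), of "axis i 1"] by blast
    show ?thesis unfolding E_def
    proof (rule bexI[OF _ e(2)[of e]], intro allI impI)
      fix j assume "j \<noteq> i"
      then show "(z + e *\<^sub>R axis i 1)$j < (z + e *\<^sub>R axis i 1)$i"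
        using z(2) z(3)[OF that(2)] z(3)[of j] e(1) by (cases "j = k") (auto simp: axis_def)
    qed (use e(1) in auto)
  qed
  have cover: "(\<exists>i. E i) \<or> (\<exists>k. V k) \<or> T"
  proof -
    obtain z where z: "z \<in> U" using U(3) by auto
    obtain z1 z2 z3 where eq: "z1 = z$1" "z2 = z$2" "z3 = z$3" by blast
    show ?thesis unfolding E_def V_def T_def
      using z unfolding exists_3 forall_3 Bex_def
      by (smt (verit, best) eq one_neq_zero)
  qed
  have E_ex: "\<exists>i. E i"
    using cover TV VE by (metis one_neq_zero)
  have sep: "V j \<or> V k \<or> T" if "E i" "E j" and d: "i \<noteq> j" "i \<noteq> k" "j \<noteq> k" for i j k
  proof -
    obtain z where z: "z \<in> U" "\<And>j. j \<noteq> i \<Longrightarrow> z$j < z$i" using \<open>E i\<close> unfolding E_def by auto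
    obtain y where y: "y \<in> U" "\<And>i. i \<noteq> j \<Longrightarrow> y$i < y$j" using \<open>E j\<close> unfolding E_def by auto
    \<comment> \<open>By connectedness \<open>U\<close> contains a zero of \<open>?f\<close>. There
      \<open>x$i\<close> is a maximum that is attained at least twice, so the point is on leg
      \<open>V j\<close>, on leg \<open>V k\<close> or at the centre.\<close>
    let ?f = "\<lambda>z::real^3. z$i - max (z$j) (z$k)"
    have "connected (?f ` U)"
      by (intro connected_continuous_image convex_connected[OF U(2)] continuous_intros)
    moreover have "?f y \<le> 0" "?f z \<ge> 0" using z(2)[of j] z(2)[of k] y(2)[of i] d by auto
    ultimately have "0 \<in> ?f ` U" using z(1) y(1)
      by (meson connected_iff_interval imageI)
    then obtain x where x: "x \<in> U" "x$i = max (x$j) (x$k)" by auto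
    have eq: "UNIV = {i, j, k}" by (rule UNIV_3_distinct[OF d])
    have all: "(\<forall>l. Q l) \<longleftrightarrow> Q i \<and> Q j \<and> Q k" for Q
      by (metis UNIV_I empty_iff eq insert_iff)
    consider "x$j < x$k" | "x$k < x$j" | "x$j = x$k" by linarith
    then show ?thesis
    proof cases
      case 1
      then have "V j" unfolding V_def all using x d
        by (intro bexI[OF _ x(1)] exI[of _ "x$k"]) auto
      then show ?thesis ..
    next
      case 2
      then have "V k" unfolding V_def all using x d
        by (intro bexI[OF _ x(1)] exI[of _ "x$j"]) auto
      then show ?thesis by simp
    next
      case 3
      then have T unfolding T_def all using x
        by (intro bexI[OF _ x(1)] exI[of _ "x$j"]) auto
      then show ?thesis by simp
    qed
  qed
  have VT: T if Vs: "V 1" "V 2" "V 3"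
  proof -
    have 1: "\<exists>z\<in>U. \<exists>d>0. \<exists>c. \<forall>i. z$i = c - (if i = k then d else 0)" if V: "V k" for k
    proof -
      obtain z c where z: "z \<in> U" "z$k < c" "\<And>i. i \<noteq> k \<Longrightarrow> z$i = c"
        using V unfolding V_def by auto
      show ?thesis
        by (rule bexI[OF _ z(1)], rule exI[of _ "c - z$k"]) (use z in auto)
    qed
    obtain x d1 c1 where x: "x \<in> U" "d1 > 0" "\<And>i. x$i = c1 - (if i = 1 then d1 else 0)"
      using 1[OF Vs(1)] by blast
    obtain y d2 c2 where y: "y \<in> U" "d2 > 0" "\<And>i. y$i = c2 - (if i = 2 then d2 else 0)"
      using 1[OF Vs(2)] by blast
    obtain z d3 c3 where z: "z \<in> U" "d3 > 0" "\<And>i. z$i = c3 - (if i = 3 then d3 else 0)"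
      using 1[OF Vs(3)] by blast
    \<comment> \<open>The weights are inversely proportional to the deficits \<open>d1\<close>,
      \<open>d2\<close>, \<open>d3\<close>. In the convex combination every coordinate then loses
      the same amount \<open>1 / S\<close>, so all three coordinates agree.\<close>
    define S where "S = inverse d1 + inverse d2 + inverse d3"
    define p1 p2 p3 where p: "p1 = inverse d1 / S" "p2 = inverse d2 / S" "p3 = inverse d3 / S"
    have S: "S > 0" unfolding S_def using x y z by (simp add: add_pos_pos)
    have p_pos: "p1 \<ge> 0" "p2 \<ge> 0" "p3 \<ge> 0" unfolding p using S x y z by auto
    have "p1 + p2 + p3 = S / S" unfolding p by (simp only: add_divide_distrib S_def)
    then have p_sum: "p1 + p2 + p3 = 1" using S by simp
    have pd: "p1 * d1 = 1 / S" "p2 * d2 = 1 / S" "p3 * d3 = 1 / S"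
      unfolding p using x y z by (simp_all add: field_simps)
    have "p1 *\<^sub>R x + p2 *\<^sub>R y + p3 *\<^sub>R z \<in> U"
      using convex_sum[of UNIV U "\<lambda>i::3. if i = 1 then p1 else if i = 2 then p2 else p3"
          "\<lambda>i. if i = 1 then x else if i = 2 then y else z"] U(2) x(1) y(1) z(1) p_pos p_sum
      by (simp add: sum_3)
    moreover have "\<forall>i. (p1 *\<^sub>R x + p2 *\<^sub>R y + p3 *\<^sub>R z)$i
        = p1 * c1 + p2 * c2 + p3 * c3 - 1 / S"
      unfolding forall_3 using pd by (simp add: x(3) y(3) z(3) algebra_simps)
    ultimately show ?thesis unfolding T_def by blast
  qed
  have "{i. E i} = (if E 1 then {1} else {}) \<union> (if E 2 then {2} else {}) \<union> (if E 3 then {3} else {})"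
    (is "_ = ?R")
  proof (rule set_eqI)
    show "i \<in> {i. E i} \<longleftrightarrow> i \<in> ?R" for i using exhaust_3[of i] by auto
  qed
  then have card: "int (card {i. E i}) = of_bool (E 1) + of_bool (E 2) + of_bool (E 3)"
    by auto
  have n: "(1::3) \<noteq> 2" "(1::3) \<noteq> 3" "(2::3) \<noteq> 3" "(2::3) \<noteq> 1" "(3::3) \<noteq> 1" "(3::3) \<noteq> 2" by auto
  \<comment> \<open>These are the possible patterns: the whole tripod, no leg and one region, one
    leg and its two neighbouring regions, or two legs and all regions. The formula holds in
    each.\<close>
  have "T \<and> (V 1 \<and> V 2 \<and> V 3) \<and> (E 1 \<and> E 2 \<and> E 3) \<or>
    \<not> T \<and> ((\<not> V 1 \<and> \<not> V 2 \<and> \<not> V 3) \<and>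
        (E 1 \<and> \<not> E 2 \<and> \<not> E 3 \<or> \<not> E 1 \<and> E 2 \<and> \<not> E 3 \<or> \<not> E 1 \<and> \<not> E 2 \<and> E 3) \<or>
      (\<not> V 1 \<and> \<not> V 2 \<and> V 3) \<and> (E 1 \<and> E 2 \<and> \<not> E 3) \<or>
      (\<not> V 1 \<and> V 2 \<and> \<not> V 3) \<and> (E 1 \<and> \<not> E 2 \<and> E 3) \<or>
      (V 1 \<and> \<not> V 2 \<and> \<not> V 3) \<and> (\<not> E 1 \<and> E 2 \<and> E 3) \<or>
      (V 1 \<and> V 2 \<and> \<not> V 3 \<or> V 1 \<and> \<not> V 2 \<and> V 3 \<or> \<not> V 1 \<and> V 2 \<and> V 3) \<and>
        (E 1 \<and> E 2 \<and> E 3))"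
    using E_ex[unfolded exists_3] VT
      TV[of 1] TV[of 2] TV[of 3]
      VE[OF _ n(1)] VE[OF _ n(2)] VE[OF _ n(3)] VE[OF _ n(4)] VE[OF _ n(5)] VE[OF _ n(6)]
      sep[OF _ _ n(1) n(2) n(3)] sep[OF _ _ n(2) n(1) n(6)] sep[OF _ _ n(3) n(4) n(5)]
      sep[OF _ _ n(4) n(3) n(2)] sep[OF _ _ n(5) n(6) n(1)] sep[OF _ _ n(6) n(5) n(4)]
    by argo
  then show ?thesis unfolding card sum_3 by (elim disjE conjE) simp_all
qed

text \<open>Counts words by the shorter word they extend. It serves twice: for letters put in front
  in \<open>lang\<close> and for letters appended in \<open>edge_lang\<close>.\<close>

lemma card_extensions:
  fixes f :: "'b \<Rightarrow> 'c::finite \<Rightarrow> 'd"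
  assumes "finite A" "\<And>w i w' i'. f w i = f w' i' \<Longrightarrow> w = w' \<and> i = i'"
    and "\<And>x. x \<in> B \<Longrightarrow> \<exists>w\<in>A. \<exists>i. x = f w i"
  shows "card B = (\<Sum>w\<in>A. card {i. f w i \<in> B})"
proof -
  have "B = (\<lambda>(w, i). f w i) ` (SIGMA w:A. {i. f w i \<in> B})"
    using assms(3) by force
  moreover have "inj_on (\<lambda>(w, i). f w i) (SIGMA w:A. {i. f w i \<in> B})"
    using assms(2) by (auto simp: inj_on_def)
  ultimately have "card B = card (SIGMA w:A. {i. f w i \<in> B})"
    by (metis card_image)
  then show ?thesis using assms(1) by simp
qed

lemma open_coordinate_less: "open {z :: real^'n. z$i + c < z$j + d}"
  by (intro open_Collect_less continuous_intros)

lemma convex_coordinate_less: "convex {z :: real^'n. z$i + c < z$j + d}"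
proof -
  have "{z :: real^'n. z$i + c < z$j + d} = {z. inner (axis i 1 - axis j 1) z < d - c}"
    by (auto simp: inner_diff_left inner_axis')
  then show ?thesis by (simp add: convex_halfspace_lt)
qed

subsection \<open>Merging three arithmetic progressions\<close>

text \<open>
  The unfolded trajectory meets the planes orthogonal to axis \<open>i\<close> with period \<open>a $ i\<close>. A state \<open>z\<close>
  records the time \<open>z $ i\<close> of the last such event for each \<open>i\<close>, so the next one happens at
  \<open>z $ i + a $ i\<close>.
\<close>

locale three_periods =
  fixes a :: "real^3"
  assumes pos: "0 < a $ i"
    and indep: "(\<Sum>i\<in>UNIV. of_int (m i) * a $ i) = 0 \<Longrightarrow> m i = 0"
begin

lemma indep3:
  fixes p q r :: int
  assumes "i \<noteq> j" "i \<noteq> k" "j \<noteq> k" "of_int p * a$i + of_int q * a$j + of_int r * a$k = 0"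
  shows "p = 0" "q = 0" "r = 0"
proof -
  define m where "m l = (if l = i then p else if l = j then q else r)" for l
  have "(\<Sum>l\<in>UNIV. of_int (m l) * a $ l) = 0"
    unfolding UNIV_3_distinct[OF assms(1-3)] using assms by (auto simp: m_def)
  then have "m l = 0" for l by (rule indep)
  from this[of i] this[of j] this[of k] show "p = 0" "q = 0" "r = 0"
    using assms(1-3) by (auto simp: m_def)
qed

lemma indep2:
  fixes p q :: int
  assumes "i \<noteq> j" "of_int p * a$i = of_int q * a$j"
  shows "p = 0" "q = 0"
proof -
  obtain k where "k \<noteq> i" "k \<noteq> j" using obtain_third_3[OF assms(1)] by metis
  then show "p = 0" "q = 0"
    using indep3[of i j k p "-q" 0] assms by auto
qed

text \<open>Equivalently, some instant lies strictly after all last events and strictly before all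
  next ones, so the state is a consistent snapshot of the three progressions.\<close>

definition fresh :: "real^3 \<Rightarrow> bool" where
  "fresh z \<longleftrightarrow> (\<forall>i j. z$i < z$j + a$j)"

definition advance :: "3 \<Rightarrow> real^3 \<Rightarrow> real^3" where
  "advance i z = z + axis i (a$i)"

text \<open>Only letter counts enter, so states after words with equal counts can be identified even
  if the order differs; whether \<open>w\<close> is the true order is left to
  \<open>codes\<close>.\<close>

definition run :: "3 list \<Rightarrow> real^3 \<Rightarrow> real^3" where
  "run w z = z + (\<chi> i. of_nat (count_list w i) * a$i)"

definition first :: "3 \<Rightarrow> real^3 \<Rightarrow> bool" where
  "first i z \<longleftrightarrow> (\<forall>j. j \<noteq> i \<longrightarrow> z$i + a$i < z$j + a$j)"

primrec codes :: "3 list \<Rightarrow> real^3 \<Rightarrow> bool" where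
  "codes [] z \<longleftrightarrow> True"
| "codes (i # w) z \<longleftrightarrow> first i z \<and> codes w (advance i z)"

lemma advance_nth: "advance i z $ j = z$j + (if j = i then a$i else 0)"
  by (simp add: advance_def axis_def)

lemma run_nth: "run w z $ i = z$i + of_nat (count_list w i) * a$i"
  by (simp add: run_def)

lemma run_Nil [simp]: "run [] z = z"
  by (simp add: vec_eq_iff run_nth)

lemma run_Cons: "run (i # w) z = run w (advance i z)"
  by (simp add: vec_eq_iff run_nth advance_nth algebra_simps)

lemma codes_append: "codes (u @ v) z \<longleftrightarrow> codes u z \<and> codes v (run u z)"
  by (induction u arbitrary: z) (auto simp: run_Cons)

lemma first_unique: "first i z \<Longrightarrow> first j z \<Longrightarrow> i = j"
  unfolding first_def by (metis less_asym)

lemma codes_unique: "codes u z \<Longrightarrow> codes v z \<Longrightarrow> length u = length v \<Longrightarrow> u = v"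
proof (induction u arbitrary: v z)
  case (Cons i u)
  then show ?case by (cases v) (auto dest: first_unique)
qed simp

lemma fresh_advance:
  assumes "fresh z" "first i z"
  shows "fresh (advance i z)"
  unfolding fresh_def
proof (intro allI)
  fix j k
  show "advance i z $ j < advance i z $ k + a$k"
    using assms pos[of i] pos[of k] unfolding fresh_def first_def advance_nth
    by (cases "j = i"; cases "k = i") (auto intro: less_trans, smt (verit))
qed

lemma fresh_run: "fresh z \<Longrightarrow> codes w z \<Longrightarrow> fresh (run w z)"
  by (induction w arbitrary: z) (auto simp: run_Cons fresh_advance)

text \<open>The counts of letters at two fresh states of one orbit are comparable componentwise.\<close>

lemma fresh_run_counts:
  assumes "fresh (run u z)" "fresh (run v z)" "length u = length v"
  shows "count_list u i = count_list v i"
proof -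
  have le: "\<forall>i. count_list u i \<le> count_list v i"
    if "fresh (run u z)" "fresh (run v z)" "count_list u j < count_list v j" for u v j
  proof (rule ccontr)
    assume "\<not> ?thesis"
    then obtain i where i: "count_list v i < count_list u i" by (auto simp: not_le)
    \<comment> \<open>If \<open>u\<close> is ahead in \<open>i\<close> and \<open>v\<close> is ahead
      in \<open>j\<close>, freshness of \<open>run u z\<close> puts event number
      \<open>count_list u i\<close> of \<open>i\<close> before event number
      \<open>count_list v j\<close> of \<open>j\<close>, and freshness of \<open>run v z\<close>
      puts them in the opposite order.\<close>
    have "(real (count_list v i) + 1) * a$i \<le> real (count_list u i) * a$i"
      "(real (count_list u j) + 1) * a$j \<le> real (count_list v j) * a$j"
      using i that(3) pos by (auto intro!: mult_right_mono simp: less_imp_le)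
    moreover have "run u z $ i < run u z $ j + a$j" "run v z $ j < run v z $ i + a$i"
      using that unfolding fresh_def by blast+
    ultimately show False unfolding run_nth by (simp add: algebra_simps)
  qed
  have sums: "(\<Sum>i\<in>UNIV. count_list u i) = (\<Sum>i\<in>UNIV. count_list v i)"
    using assms(3) by (metis finite sum_count_set subset_UNIV)
  have eq: "\<forall>i. count_list u i = count_list v i"
    if "\<forall>i. count_list u i \<le> count_list v i"
      "(\<Sum>i\<in>UNIV. count_list u i) = (\<Sum>i\<in>UNIV. count_list v i)" for u v :: "3 list"
    by (metis sum_mono_inv that UNIV_I finite)
  show ?thesis
  proof (cases "\<exists>j. count_list u j < count_list v j")
    case True
    then show ?thesis using le[OF assms(1,2)] eq[of u v] sums by blast
  next
    case False
    then show ?thesis using eq[of v u] sums by (simp add: not_less)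
  qed
qed

text \<open>\<open>N\<close> counts the events strictly before time \<open>t\<close>. The word is
  built by removing the earliest event. Ties are excluded only before \<open>t\<close>: a tie at
  \<open>t\<close> itself must be allowed for \<open>tie_exists\<close>.\<close>

lemma exists_word:
  fixes N :: "3 \<Rightarrow> nat"
  assumes "\<And>i. z$i + of_nat (N i) * a$i < t" "\<And>i. t \<le> z$i + (of_nat (N i) + 1) * a$i"
    and "\<And>i j m l. i \<noteq> j \<Longrightarrow> m \<ge> 1 \<Longrightarrow> l \<ge> 1 \<Longrightarrow>
      z$i + of_nat m * a$i = z$j + of_nat l * a$j \<Longrightarrow> t \<le> z$i + of_nat m * a$i"
  shows "\<exists>w. codes w z \<and> (\<forall>i. count_list w i = N i)"
  using assms
proof (induction "\<Sum>i\<in>UNIV. N i" arbitrary: z N)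
  case 0
  then show ?case by (intro exI[of _ "[]"]) auto
next
  case (Suc n)
  obtain i where i: "\<And>j. z$i + a$i \<le> z$j + a$j"
    using arg_min_if_finite(2)[of UNIV "\<lambda>i. z$i + a$i"] by (meson UNIV_I UNIV_not_empty finite not_le)
  obtain j where j: "N j \<noteq> 0" using Suc.hyps(2) by (metis nat.simps(3) sum.neutral)
  have "a$j \<le> of_nat (N j) * a$j" using j pos[of j] by simp
  then have it: "z$i + a$i < t" using i[of j] Suc.prems(1)[of j] by linarith
  then have Ni: "N i \<noteq> 0" using Suc.prems(2)[of i] by (intro notI) simp
  have first: "first i z" unfolding first_def
  proof (intro allI impI)
    fix j assume "j \<noteq> i"
    then have "z$i + a$i \<noteq> z$j + a$j" using Suc.prems(3)[of i j 1 1] it by auto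
    then show "z$i + a$i < z$j + a$j" using i[of j] by linarith
  qed
  define M where "M = N(i := N i - 1)"
  have N: "N j = M j + (if j = i then 1 else 0)" for j using Ni by (auto simp: M_def)
  have "Suc n = (\<Sum>j\<in>UNIV. M j) + 1" unfolding Suc.hyps(2) N sum.distrib by simp
  then have "n = (\<Sum>j\<in>UNIV. M j)" by simp
  moreover have "advance i z $ j + of_nat (M j) * a$j = z$j + of_nat (N j) * a$j"
    "advance i z $ j + (of_nat (M j) + 1) * a$j = z$j + (of_nat (N j) + 1) * a$j" for j
    by (auto simp: advance_nth N algebra_simps)
  moreover have "t \<le> advance i z $ j + of_nat m * a$j"
    if "j \<noteq> k" "m \<ge> 1" "l \<ge> 1"
      "advance i z $ j + of_nat m * a$j = advance i z $ k + of_nat l * a$k" for j k m l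
  proof -
    have eq: "advance i z $ j + of_nat m * a$j = z$j + of_nat (m + (if j = i then 1 else 0)) * a$j"
      for j m by (simp add: advance_nth algebra_simps)
    show ?thesis using that(2-4) unfolding eq
      by (intro Suc.prems(3)[OF that(1), where l = "l + (if k = i then 1 else 0)"]) auto
  qed
  ultimately obtain w where "codes w (advance i z)" "\<forall>j. count_list w j = M j"
    using Suc.hyps(1)[of M "advance i z"] Suc.prems by metis
  then show ?case using first by (intro exI[of _ "i # w"]) (auto simp: N)
qed

section \<open>Words of given length and their left extensions\<close>

definition lang :: "nat \<Rightarrow> 3 list set" where
  "lang n = {w. length w = n \<and> (\<exists>z. fresh z \<and> codes w z)}"

text \<open>At time 0 the two letters other than \<open>k\<close> occur together, so the unfolded
  line starts on an edge parallel to axis \<open>k\<close>. The free parameter \<open>x\<close> is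
  the last time of letter \<open>k\<close>.\<close>

definition edge_lang :: "3 \<Rightarrow> nat \<Rightarrow> 3 list set" where
  "edge_lang k n = {w. length w = n \<and> (\<exists>x. - a$k < x \<and> x < 0 \<and> codes w (axis k x))}"

definition vertex_lang :: "nat \<Rightarrow> 3 list set" where
  "vertex_lang n = {w. length w = n \<and> codes w 0}"

lemma finite_length_3: "finite {w :: 3 list. length w = n}"
  using finite_lists_length_eq[of "UNIV :: 3 set" n] by simp

lemma finite_lang: "finite (lang n)"
  by (rule finite_subset[OF _ finite_length_3[of n]]) (auto simp: lang_def)

lemma finite_edge_lang: "finite (edge_lang k n)"
  by (rule finite_subset[OF _ finite_length_3[of n]]) (auto simp: edge_lang_def)

lemma open_first: "open {z. first i z}"
  unfolding first_def Collect_all_eq Collect_imp_eq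
  by (intro open_INT ballI finite) (cases "\<exists>j. j \<noteq> i"; auto intro!: open_Un open_coordinate_less)

lemma convex_first: "convex {z. first i z}"
proof -
  have "{z. first i z} = (\<Inter>j\<in>-{i}. {z. z$i + a$i < z$j + a$j})" by (auto simp: first_def)
  then show ?thesis by (auto intro!: convex_INT convex_coordinate_less)
qed

lemma codes_Cons_set: "{z. codes (i # w) z} = {z. first i z} \<inter> (\<lambda>z. z + axis i (a$i)) -` {z. codes w z}"
  by (auto simp: advance_def)

lemma open_codes: "open {z. codes w z}"
proof (induction w)
  case (Cons i w)
  then show ?case unfolding codes_Cons_set
    by (intro open_Int open_first open_vimage continuous_intros)
qed simp

lemma convex_codes: "convex {z. codes w z}"
proof (induction w)
  case (Cons i w)
  have "(\<lambda>z. z + axis i (a$i)) -` {z. codes w z} = (\<lambda>z. - axis i (a$i) + z) ` {z. codes w z}"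
    by (force simp: image_iff)
  with Cons show ?case unfolding codes_Cons_set
    by (metis convex_Int convex_first convex_translation)
qed simp

lemma fresh_set: "{z. fresh z} = (\<Inter>i. \<Inter>j. {z. z$i + 0 < z$j + a$j})"
  by (auto simp: fresh_def)

lemma open_fresh: "open {z. fresh z}"
  unfolding fresh_set by (intro open_INT ballI finite open_coordinate_less)

lemma convex_fresh: "convex {z. fresh z}"
  unfolding fresh_set by (intro convex_INT convex_coordinate_less)

lemma first_shift: "first i (z + vec c) \<longleftrightarrow> first i z"
  by (auto simp: first_def)

text \<open>Only differences of times matter, which makes the space of states effectively a
  plane.\<close>

lemma codes_shift: "codes w (z + vec c) \<longleftrightarrow> codes w z"
proof (induction w arbitrary: z)
  case (Cons i w)
  have "advance i (z + vec c) = advance i z + vec c" by (simp add: advance_def)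
  then show ?case using Cons first_shift by simp
qed simp

text \<open>The letter before \<open>w\<close> is the one whose last event is the most recent.
  Undoing that event subtracts \<open>a$i\<close> from coordinate \<open>i\<close>, and freshness of
  \<open>z\<close> makes \<open>i\<close> the first letter of the earlier state.\<close>

lemma lang_left_extension:
  assumes "length w = n"
  shows "i # w \<in> lang (Suc n) \<longleftrightarrow> (\<exists>z\<in>{z. fresh z} \<inter> {z. codes w z}. \<forall>j. j \<noteq> i \<longrightarrow> z$j < z$i)"
proof
  assume "i # w \<in> lang (Suc n)"
  then obtain z where z: "fresh z" "first i z" "codes w (advance i z)" by (auto simp: lang_def)
  show "\<exists>z\<in>{z. fresh z} \<inter> {z. codes w z}. \<forall>j. j \<noteq> i \<longrightarrow> z$j < z$i"
    by (rule bexI[of _ "advance i z"])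
      (use z fresh_advance[OF z(1,2)] in \<open>auto simp: advance_nth fresh_def\<close>)
next
  assume "\<exists>z\<in>{z. fresh z} \<inter> {z. codes w z}. \<forall>j. j \<noteq> i \<longrightarrow> z$j < z$i"
  then obtain z where z: "fresh z" "codes w z" "\<And>j. j \<noteq> i \<Longrightarrow> z$j < z$i" by auto
  define y where "y = z - axis i (a$i)"
  have y: "advance i y = z" "\<And>j. y$j = z$j - (if j = i then a$i else 0)"
    by (auto simp: y_def advance_def axis_def)
  have "fresh y" unfolding fresh_def
  proof (intro allI)
    fix j k
    show "y$j < y$k + a$k"
      using z(1) z(3)[of j] pos[of i] pos[of k] unfolding fresh_def y(2)
      by (cases "j = i"; cases "k = i") (auto, smt (verit))
  qed
  moreover have "first i y"
    using z(1) by (auto simp: first_def fresh_def y(2))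
  ultimately show "i # w \<in> lang (Suc n)"
    using assms z(2) y(1) by (auto simp: lang_def)
qed

text \<open>Shifting time by \<open>c\<close> moves the simultaneous pair of events to time 0;
  freshness is then the lower bound \<open>- a$k < x\<close>. The right-hand side is a leg of the
  tripod.\<close>

lemma edge_lang_iff:
  assumes "length w = n"
  shows "w \<in> edge_lang k n \<longleftrightarrow>
    (\<exists>z\<in>{z. fresh z} \<inter> {z. codes w z}. \<exists>c. z$k < c \<and> (\<forall>i. i \<noteq> k \<longrightarrow> z$i = c))"
proof
  assume "w \<in> edge_lang k n"
  then obtain x where x: "- a$k < x" "x < 0" "codes w (axis k x)" by (auto simp: edge_lang_def)
  show "\<exists>z\<in>{z. fresh z} \<inter> {z. codes w z}. \<exists>c. z$k < c \<and> (\<forall>i. i \<noteq> k \<longrightarrow> z$i = c)"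
  proof (intro bexI exI)
    have "axis k x $ i < axis k x $ j + a$j" for i j
      using x pos[of j] by (auto simp: axis_def)
    then show "axis k x \<in> {z. fresh z} \<inter> {z. codes w z}"
      using x by (auto simp: fresh_def)
    show "axis k x $ k < 0 \<and> (\<forall>i. i \<noteq> k \<longrightarrow> axis k x $ i = 0)"
      using x by (auto simp: axis_def)
  qed
next
  assume "\<exists>z\<in>{z. fresh z} \<inter> {z. codes w z}. \<exists>c. z$k < c \<and> (\<forall>i. i \<noteq> k \<longrightarrow> z$i = c)"
  then obtain z c where z: "fresh z" "codes w z" "z$k < c" "\<And>i. i \<noteq> k \<Longrightarrow> z$i = c" by auto
  have eq: "z = axis k (z$k - c) + vec c"
    using z(4) by (auto simp: vec_eq_iff axis_def)
  obtain i where "i \<noteq> k" using exists_3[of "\<lambda>i. i \<noteq> k"] by fastforce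
  then have "c < z$k + a$k" using z(1) z(4)[of i] unfolding fresh_def by metis
  moreover have "codes w (axis k (z$k - c))" using z(2) eq codes_shift by metis
  ultimately show "w \<in> edge_lang k n" using z(3) assms
    by (auto simp: edge_lang_def intro!: exI[of _ "z$k - c"])
qed

lemma vertex_lang_iff:
  assumes "length w = n"
  shows "w \<in> vertex_lang n \<longleftrightarrow> (\<exists>z\<in>{z. fresh z} \<inter> {z. codes w z}. \<exists>c. \<forall>i. z$i = c)"
proof
  assume "w \<in> vertex_lang n"
  then show "\<exists>z\<in>{z. fresh z} \<inter> {z. codes w z}. \<exists>c. \<forall>i. z$i = c"
    by (intro bexI[of _ 0]) (auto simp: vertex_lang_def fresh_def pos)
next
  assume "\<exists>z\<in>{z. fresh z} \<inter> {z. codes w z}. \<exists>c. \<forall>i. z$i = c"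
  then obtain z c where z: "codes w z" "\<forall>i. z$i = c" by auto
  then have "z = 0 + vec c" by (auto simp: vec_eq_iff)
  then show "w \<in> vertex_lang n" using z(1) codes_shift assms by (metis (mono_tags) mem_Collect_eq vertex_lang_def)
qed

lemma edge_lang_subset: "edge_lang k n \<subseteq> lang n"
proof
  fix w assume w: "w \<in> edge_lang k n"
  then have "length w = n" by (simp add: edge_lang_def)
  then show "w \<in> lang n" using w edge_lang_iff[of w n k] by (auto simp: lang_def)
qed

lemma vertex_lang_subset: "vertex_lang n \<subseteq> lang n"
  using pos by (auto simp: vertex_lang_def lang_def fresh_def intro!: exI[of _ 0])

text \<open>The fresh states coding a fixed \<open>w\<close> form a nonempty open convex set, to
  which \<open>tripod_count\<close> applies. Summing over \<open>w\<close> turns legs into edge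
  words and centres into vertex words.\<close>

lemma card_lang_Suc:
  "int (card (lang (Suc n))) =
     int (card (lang n)) + (\<Sum>k\<in>UNIV. int (card (edge_lang k n))) - int (card (vertex_lang n))"
proof -
  have "card (lang (Suc n)) = (\<Sum>w\<in>lang n. card {i. i # w \<in> lang (Suc n)})"
  proof (rule card_extensions[OF finite_lang])
    fix x assume "x \<in> lang (Suc n)"
    then obtain z where z: "length x = Suc n" "fresh z" "codes x z" by (auto simp: lang_def)
    then obtain i w where x: "x = i # w" by (cases x) auto
    then have "w \<in> lang n" using z fresh_advance[of z i] by (auto simp: lang_def)
    then show "\<exists>w\<in>lang n. \<exists>i. x = i # w" using x by blast
  qed auto
  then have "int (card (lang (Suc n))) = (\<Sum>w\<in>lang n. int (card {i. i # w \<in> lang (Suc n)}))"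
    by simp
  also have "\<dots> = (\<Sum>w\<in>lang n. 1 + (\<Sum>k\<in>UNIV. of_bool (w \<in> edge_lang k n)) - of_bool (w \<in> vertex_lang n))"
  proof (rule sum.cong[OF refl])
    fix w assume w: "w \<in> lang n"
    then have l: "length w = n" by (simp add: lang_def)
    show "int (card {i. i # w \<in> lang (Suc n)}) =
        1 + (\<Sum>k\<in>UNIV. of_bool (w \<in> edge_lang k n)) - of_bool (w \<in> vertex_lang n)"
      unfolding lang_left_extension[OF l] edge_lang_iff[OF l] vertex_lang_iff[OF l]
      by (rule tripod_count)
        (use w in \<open>auto simp: lang_def intro!: open_Int convex_Int open_fresh convex_fresh open_codes convex_codes\<close>)
  qed
  also have "\<dots> = int (card (lang n)) + (\<Sum>k\<in>UNIV. \<Sum>w\<in>lang n. of_bool (w \<in> edge_lang k n))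
      - (\<Sum>w\<in>lang n. of_bool (w \<in> vertex_lang n))"
    by (simp only: sum_subtractf sum.distrib sum.swap[of _ UNIV "lang n"]) simp
  also have "(\<Sum>w\<in>lang n. of_bool (w \<in> vertex_lang n)) = int (card (vertex_lang n))"
    using vertex_lang_subset[of n] finite_lang[of n] by (simp add: sum_of_bool_eq Int_absorb1)
  also have "(\<Sum>k\<in>UNIV. \<Sum>w\<in>lang n. of_bool (w \<in> edge_lang k n))
      = (\<Sum>k\<in>UNIV. int (card (edge_lang k n)))"
    using edge_lang_subset[of _ n] finite_lang[of n]
    by (intro sum.cong) (simp_all add: sum_of_bool_eq Int_absorb1)
  finally show ?thesis .
qed

subsection \<open>Words starting from an edge\<close>

lemma run_axis_nth:
  "run w (axis k x) $ l = (if l = k then x else 0) + of_nat (count_list w l) * a$l"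
  by (auto simp: run_nth axis_def)

lemma fresh_axis:
  assumes "- a$k < x" "x < 0"
  shows "fresh (axis k x)"
  unfolding fresh_def
proof (intro allI)
  fix i j
  show "axis k x $ i < axis k x $ j + a$j" using assms pos[of j] by (auto simp: axis_def)
qed

lemma fresh_0: "fresh 0"
  by (simp add: fresh_def pos)

text \<open>A generalized diagonal: the line that leaves an edge parallel to axis \<open>k\<close>
  with parameter \<open>x\<close> meets, right after \<open>w\<close>, an edge where
  \<open>k\<close> occurs together with another letter.\<close>

definition tie :: "3 \<Rightarrow> 3 list \<Rightarrow> real \<Rightarrow> bool" where
  "tie k w x \<longleftrightarrow> - a$k < x \<and> x < 0 \<and> codes w (axis k x) \<and>
     (\<exists>j. j \<noteq> k \<and> run w (axis k x) $ j + a$j = run w (axis k x) $ k + a$k) \<and>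
     (\<forall>l. run w (axis k x) $ k + a$k \<le> run w (axis k x) $ l + a$l)"

text \<open>The parameters coding \<open>w\<close> form an open interval \<open>I\<close>. The next
  times \<open>c j < c m\<close> of the other two letters are fixed, while that of \<open>k\<close>
  slides with \<open>x\<close>. So \<open>k\<close> follows for \<open>x < e\<close> and
  \<open>j\<close> for \<open>e < x\<close>, and both occur exactly if \<open>e\<close> lies in
  \<open>I\<close>.\<close>

lemma card_edge_extensions:
  assumes w: "w \<in> edge_lang k n"
  shows "card {i. w @ [i] \<in> edge_lang k (Suc n)} = 1 + of_bool (\<exists>x. tie k w x)"
proof -
  define c where "c l = (of_nat (count_list w l) + 1) * a$l" for l
  define I where "I = {- a$k<..<0} \<inter> (\<lambda>x. x *\<^sub>R axis k (1::real)) -` {z. codes w z}"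
  have axis: "axis k x = x *\<^sub>R axis k (1::real)" for x by (auto simp: vec_eq_iff axis_def)
  have I: "x \<in> I \<longleftrightarrow> - a$k < x \<and> x < 0 \<and> codes w (axis k x)" for x
    unfolding I_def axis[of x] by auto
  have "open I" unfolding I_def
    by (intro open_Int open_vimage open_codes continuous_intros)
  have "convex I" unfolding I_def
    by (intro convex_Int convex_linear_vimage convex_codes linearI) (auto simp: algebra_simps)
  then have between: "y \<in> I" if "x \<in> I" "z \<in> I" "x < y" "y < z" for x y z
    using that is_interval_convex_1 mem_is_interval_1_I by (metis less_imp_le)
  have next_time: "run w (axis k x) $ l + a$l = (if l = k then x else 0) + c l" for x l
    by (simp add: run_axis_nth c_def algebra_simps)
  have c_neq: "c l \<noteq> c m" if "l \<noteq> m" for l m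
    using indep2[OF that, of "int (count_list w l) + 1" "int (count_list w m) + 1"]
    by (auto simp: c_def)
  obtain j m where jm: "j \<noteq> k" "m \<noteq> k" "m \<noteq> j" "c j < c m"
  proof -
    obtain p where p: "p \<noteq> k" using exists_3[of "\<lambda>i. i \<noteq> k"] by fastforce
    then obtain q where q: "q \<noteq> k" "q \<noteq> p" using obtain_third_3 by metis
    show ?thesis using that[of p q] that[of q p] p q c_neq[of p q] by (metis linorder_neqE)
  qed
  have all: "(\<forall>l. Q l) \<longleftrightarrow> Q k \<and> Q j \<and> Q m" for Q
    using UNIV_3_distinct[of k j m] jm by (metis UNIV_I empty_iff insert_iff)
  have ex: "(\<exists>l. Q l) \<longleftrightarrow> Q k \<or> Q j \<or> Q m" for Q
    using all[of "\<lambda>l. \<not> Q l"] by blast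
  define e where "e = c j - c k"
  have first: "first k (run w (axis k x)) \<longleftrightarrow> x < e" "first j (run w (axis k x)) \<longleftrightarrow> e < x"
    "first m (run w (axis k x)) \<longleftrightarrow> False" for x
    unfolding first_def next_time all using jm by (auto simp: e_def)
  have ext: "w @ [i] \<in> edge_lang k (Suc n) \<longleftrightarrow> (\<exists>x\<in>I. first i (run w (axis k x)))" for i
    using w by (auto simp: edge_lang_def codes_append I)
  have "{i. w @ [i] \<in> edge_lang k (Suc n)} =
      (if \<exists>x\<in>I. x < e then {k} else {}) \<union> (if \<exists>x\<in>I. e < x then {j} else {})" (is "_ = ?R")
  proof -
    have "\<forall>i. (\<exists>x\<in>I. first i (run w (axis k x))) \<longleftrightarrow> i \<in> ?R"
      unfolding all first using jm by auto
    then show ?thesis unfolding ext by blast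
  qed
  then have card: "card {i. w @ [i] \<in> edge_lang k (Suc n)} =
      of_bool (\<exists>x\<in>I. x < e) + of_bool (\<exists>x\<in>I. e < x)"
    using jm by simp
  have "tie k w x \<longleftrightarrow> x \<in> I \<and> x = e" for x
    unfolding tie_def I next_time all ex using jm
    by (auto simp: e_def)
  then have tie: "(\<exists>x. tie k w x) \<longleftrightarrow> e \<in> I" by auto
  show ?thesis
  proof (cases "e \<in> I")
    case True
    obtain d where d: "d > 0" "\<And>t. \<bar>t\<bar> \<le> d \<Longrightarrow> e + t *\<^sub>R 1 \<in> I"
      using open_ray[OF \<open>open I\<close> True, of 1] by blast
    have "e + d \<in> I" "e - d \<in> I" using d(1) d(2)[of d] d(2)[of "-d"] by simp_all
    then have "\<exists>x\<in>I. e < x" "\<exists>x\<in>I. x < e"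
      using d(1) by (intro bexI[of _ "e + d"] bexI[of _ "e - d"]; simp)+
    then show ?thesis unfolding card tie using True by simp
  next
    case False
    obtain x where "x \<in> I" using w by (auto simp: edge_lang_def I)
    then have "(\<exists>x\<in>I. x < e) \<or> (\<exists>x\<in>I. e < x)" using False by (metis linorder_neqE)
    moreover have "\<not> ((\<exists>x\<in>I. x < e) \<and> (\<exists>x\<in>I. e < x))" using between False by blast
    ultimately show ?thesis unfolding card tie using False by auto
  qed
qed

text \<open>Replacing \<open>x\<close> by 0 turns the state at the tie into a fresh state of the
  vertex orbit, which has the same letter counts as \<open>u\<close>. There \<open>k\<close> is
  delayed by \<open>- x > 0\<close>, so its partner \<open>j\<close> in the tie comes first; this
  identifies \<open>i\<close> with \<open>j\<close> and determines \<open>x\<close>.\<close>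

lemma tieD:
  assumes "tie k w x" "codes u 0" "first i (run u 0)" "length w = length u"
  shows "i \<noteq> k" "x = run u 0 $ i + a$i - (run u 0 $ k + a$k)"
proof -
  let ?s = "run w (axis k x)"
  obtain j where x: "- a$k < x" "x < 0" "codes w (axis k x)"
    and j: "j \<noteq> k" "?s$j + a$j = ?s$k + a$k" "\<And>l. ?s$k + a$k \<le> ?s$l + a$l"
    using assms(1) by (auto simp: tie_def)
  have s0: "run w 0 $ l = ?s$l - (if l = k then x else 0)" for l
    unfolding run_axis_nth by (simp add: run_nth)
  have "fresh ?s" using fresh_run[OF fresh_axis] x by blast
  \<comment> \<open>The delay \<open>- x\<close> is less than \<open>a$k\<close>, so the last event
    of \<open>k\<close> still precedes the time of the tie, and no next event is earlier than the
    tie.\<close>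
  have "fresh (run w 0)" unfolding fresh_def
  proof (intro allI)
    fix p q
    have "?s$p < ?s$q + a$q" using \<open>fresh ?s\<close> by (simp add: fresh_def)
    then show "run w 0 $ p < run w 0 $ q + a$q"
      using x pos[of q] j(3)[of q] unfolding s0 by auto
  qed
  then have "count_list w l = count_list u l" for l
    using fresh_run_counts fresh_run[OF fresh_0 assms(2)] assms(4) by blast
  then have u: "run u 0 = run w 0" by (simp add: vec_eq_iff run_nth)
  have "i = j"
  proof (rule ccontr)
    assume "i \<noteq> j"
    then have "run w 0 $ i + a$i < run w 0 $ j + a$j" using assms(3) by (simp add: u first_def)
    then show False unfolding s0 using j(1,2) j(3)[of i] x(2) by (auto split: if_splits)
  qed
  with j(1,2) show "i \<noteq> k" "x = run u 0 $ i + a$i - (run u 0 $ k + a$k)"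
    unfolding u s0 by auto
qed

text \<open>Let \<open>t\<close> be the time of the letter \<open>i\<close> that follows
  \<open>u\<close> on the vertex orbit. Progression \<open>k\<close> is moved back so that its next
  event falls at \<open>t\<close>, and \<open>exists_word\<close> merges everything before
  \<open>t\<close>.\<close>

lemma tie_exists:
  assumes u: "codes u 0" "first i (run u 0)" and "i \<noteq> k"
  obtains w x where "length w = length u" "tie k w x"
proof -
  define c where "c l = count_list u l" for l
  define t where "t = (of_nat (c i) + 1) * a$i"
  define x where "x = t - (of_nat (c k) + 1) * a$k"
  have fr: "fresh (run u 0)" using fresh_run[OF fresh_0 u(1)] .
  have lt: "of_nat (c l) * a$l < t" for l
  proof -
    have "run u 0 $ l < run u 0 $ i + a$i" using fr by (simp add: fresh_def)
    then show ?thesis by (simp add: run_nth t_def c_def algebra_simps)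
  qed
  have le: "t < (of_nat (c l) + 1) * a$l" if "l \<noteq> i" for l
    using u(2) that unfolding first_def run_nth t_def c_def by (auto simp: algebra_simps)
  have x: "- a$k < x" "x < 0"
    using lt[of k] le[of k] \<open>i \<noteq> k\<close> by (auto simp: x_def algebra_simps)
  have xk: "x + of_nat (c k) * a$k = t - a$k" by (simp add: x_def algebra_simps)
  have no_tie: "t \<le> axis k x $ p + of_nat m * a$p"
    if pq: "p \<noteq> q" and that: "m \<ge> 1" "l \<ge> 1"
      "axis k x $ p + of_nat m * a$p = axis k x $ q + of_nat l * a$q" for p q m l
  proof -
    \<comment> \<open>A tie of \<open>k\<close> with \<open>i\<close> can only be the intended one
      at \<open>t\<close>. A tie of \<open>k\<close> with the third letter would be a rational
      relation among all three periods in which \<open>a$i\<close> has the nonzero coefficient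
      \<open>c i + 1\<close>.\<close>
    have *: "t = x + of_nat m * a$k"
      if "q \<noteq> k" "m \<ge> 1" "l \<ge> 1" "x + of_nat m * a$k = of_nat l * a$q" for q m l
    proof (cases "q = i")
      case True
      have "of_int (int (c i) + 1 - int l) * a$i = of_int (int (c k) + 1 - int m) * a$k"
        using that(4) by (simp add: True x_def t_def algebra_simps)
      from indep2[OF \<open>i \<noteq> k\<close> this] have "l = c i + 1" "m = c k + 1" by auto
      then show ?thesis by (simp add: x_def algebra_simps)
    next
      case False
      have "of_int (int (c i) + 1) * a$i + of_int (int m - int (c k) - 1) * a$k
          + of_int (- int l) * a$q = 0"
        using that(4) by (simp add: x_def t_def algebra_simps)
      from indep3(1)[OF \<open>i \<noteq> k\<close> _ _ this] False that(1) show ?thesis by auto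
    qed
    consider "p = k" "q \<noteq> k" | "q = k" "p \<noteq> k" | "p \<noteq> k" "q \<noteq> k" using pq by auto
    then show ?thesis
    proof cases
      case 1
      then show ?thesis using *[of q m l] that pq by (auto simp: axis_def)
    next
      case 2
      then show ?thesis using *[of p l m] that pq by (auto simp: axis_def)
    next
      case 3
      then have "of_int (int m) * a$p = of_int (int l) * a$q"
        using that(3) by (auto simp: axis_def)
      from indep2(1)[OF pq this] that(1) show ?thesis by simp
    qed
  qed
  have "axis k x $ l + of_nat (c l) * a$l < t"
    "t \<le> axis k x $ l + (of_nat (c l) + 1) * a$l" for l
    using lt[of l] le[of l] xk pos[of k]
    by (cases "l = i"; auto simp: axis_def algebra_simps t_def)+
  then obtain w where w: "codes w (axis k x)" "\<And>l. count_list w l = c l"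
    using exists_word[of "axis k x" c t] no_tie by blast
  have "length w = length u"
    using w(2) sum_count_set[of w UNIV] sum_count_set[of u UNIV] by (simp add: c_def)
  moreover have "tie k w x"
    unfolding tie_def run_axis_nth w(2)
  proof (intro conjI exI[of _ i] allI)
    fix l
    show "(if k = k then x else 0) + of_nat (c k) * a$k + a$k
        \<le> (if l = k then x else 0) + of_nat (c l) * a$l + a$l"
      using le[of l] xk by (cases "l = i") (auto simp: t_def algebra_simps)
  qed (use x w(1) \<open>i \<noteq> k\<close> xk in \<open>auto simp: t_def algebra_simps\<close>)
  ultimately show ?thesis using that by blast
qed

lemma card_edge_lang_Suc:
  assumes u: "length u = n" "codes u 0" "first i (run u 0)"
  shows "card (edge_lang k (Suc n)) = card (edge_lang k n) + of_bool (i \<noteq> k)"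
proof -
  have "card (edge_lang k (Suc n)) = (\<Sum>w\<in>edge_lang k n. card {i. w @ [i] \<in> edge_lang k (Suc n)})"
  proof (rule card_extensions[OF finite_edge_lang])
    fix v assume v: "v \<in> edge_lang k (Suc n)"
    then obtain w i where "v = w @ [i]" by (cases v rule: rev_cases) (auto simp: edge_lang_def)
    with v show "\<exists>w\<in>edge_lang k n. \<exists>i. v = w @ [i]"
      by (auto simp: edge_lang_def codes_append)
  qed auto
  also have "\<dots> = (\<Sum>w\<in>edge_lang k n. 1 + of_bool (\<exists>x. tie k w x))"
    by (intro sum.cong refl card_edge_extensions)
  also have "\<dots> = card (edge_lang k n) + card {w \<in> edge_lang k n. \<exists>x. tie k w x}"
    using finite_edge_lang[of k n]
    by (simp only: sum.distrib sum_of_bool_eq Collect_conj_eq Collect_mem_eq) simp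
  also have "card {w \<in> edge_lang k n. \<exists>x. tie k w x} = of_bool (i \<noteq> k)"
  proof (cases "i = k")
    case True
    then have *: "{w \<in> edge_lang k n. \<exists>x. tie k w x} = {}"
      using tieD(1)[OF _ u(2,3)] u(1) by (auto simp: edge_lang_def)
    show ?thesis using True unfolding * by simp
  next
    case False
    then obtain w x where w: "length w = length u" "tie k w x"
      using tie_exists[OF u(2,3)] by metis
    \<comment> \<open>By \<open>tieD\<close> both ties have the same parameter, and a single
      starting state codes only one word of each length.\<close>
    have "v = w" if "length v = n" "tie k v y" for v y
    proof -
      have "y = x" using tieD(2)[OF _ u(2,3)] w that u(1) by metis
      then show ?thesis using that w codes_unique u(1) unfolding tie_def by metis
    qed
    moreover have "w \<in> edge_lang k n" using w u(1) by (auto simp: edge_lang_def tie_def)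
    ultimately have "{w \<in> edge_lang k n. \<exists>x. tie k w x} = {w}"
      using w(2) by (auto simp: edge_lang_def)
    then show ?thesis using False by simp
  qed
  finally show ?thesis .
qed

section \<open>States without later ties, and the final count\<close>

definition generic :: "real^3 \<Rightarrow> bool" where
  "generic z \<longleftrightarrow>
     (\<forall>i j m l. i \<noteq> j \<longrightarrow> z$i + of_nat (Suc m) * a$i \<noteq> z$j + of_nat (Suc l) * a$j)"

lemma generic_run: "generic z \<Longrightarrow> generic (run w z)"
proof -
  assume z: "generic z"
  have "run w z $ i + of_nat (Suc m) * a$i = z$i + of_nat (Suc (count_list w i + m)) * a$i" for i m
    by (simp add: run_nth algebra_simps)
  then show ?thesis using z unfolding generic_def by metis
qed

lemma generic_first:
  assumes "generic z"
  shows "\<exists>i. first i z"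
proof -
  obtain i where i: "\<And>j. z$i + a$i \<le> z$j + a$j"
    using arg_min_if_finite(2)[of UNIV "\<lambda>i. z$i + a$i"] by (meson UNIV_I UNIV_not_empty finite not_le)
  have "first i z" unfolding first_def
  proof (intro allI impI)
    fix j assume "j \<noteq> i"
    then have "z$i + of_nat (Suc 0) * a$i \<noteq> z$j + of_nat (Suc 0) * a$j"
      using assms unfolding generic_def by metis
    then show "z$i + a$i < z$j + a$j" using i[of j] by simp
  qed
  then show ?thesis ..
qed

lemma generic_codes: "generic z \<Longrightarrow> \<exists>w. length w = n \<and> codes w z"
proof (induction n)
  case (Suc n)
  then obtain w where w: "length w = n" "codes w z" by blast
  obtain i where "first i (run w z)" using generic_first generic_run Suc.prems by blast
  then show ?case using w by (intro exI[of _ "w @ [i]"]) (simp add: codes_append)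
qed simp

text \<open>\<open>generic\<close> compares only events after the recorded ones. Hence the
  coincidence of all three at time 0 does no harm, and independence excludes any later one.\<close>

lemma generic_0: "generic 0"
  unfolding generic_def
proof (intro allI impI notI)
  fix i j and m l :: nat
  assume ne: "i \<noteq> j"
    and "(0::real^3)$i + of_nat (Suc m) * a$i = (0::real^3)$j + of_nat (Suc l) * a$j"
  then show False using indep2(1)[OF ne, of "int (Suc m)" "int (Suc l)"] by simp
qed

lemma card_vertex_lang: "card (vertex_lang n) = 1"
proof -
  obtain w where w: "length w = n" "codes w 0" using generic_codes[OF generic_0] by blast
  then have "vertex_lang n = {w}" using codes_unique by (auto simp: vertex_lang_def)
  then show ?thesis by simp
qed

text \<open>The next letter \<open>i\<close> of the vertex word differs from exactly two of the
  three values of \<open>k\<close>, so each step adds two words.\<close>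

lemma sum_card_edge_lang: "(\<Sum>k\<in>UNIV. card (edge_lang k n)) = 2 * n + 3"
proof (induction n)
  case 0
  have "edge_lang k 0 = {[]}" for k
    using pos[of k] by (auto simp: edge_lang_def intro: exI[of _ "- a$k / 2"])
  then show ?case by simp
next
  case (Suc n)
  obtain u where u: "length u = n" "codes u 0" using generic_codes[OF generic_0] by blast
  obtain i where "first i (run u 0)" using generic_first generic_run[OF generic_0] by blast
  then have "(\<Sum>k\<in>UNIV. card (edge_lang k (Suc n)))
      = (\<Sum>k\<in>UNIV. card (edge_lang k n)) + (\<Sum>k\<in>UNIV. of_bool (i \<noteq> k))"
    using card_edge_lang_Suc[OF u] by (simp add: sum.distrib)
  also have "(\<Sum>k\<in>UNIV. of_bool (i \<noteq> k)) = (2 :: nat)"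
    using exhaust_3[of i] by (auto simp: sum_3)
  finally show ?case using Suc by simp
qed

lemma card_lang: "card (lang n) = n^2 + n + 1"
proof (induction n)
  case 0
  have "lang 0 = {[]}" using fresh_0 by (auto simp: lang_def)
  then show ?case by simp
next
  case (Suc n)
  have "int (card (lang (Suc n))) = int (n^2 + n + 1) + int (2 * n + 3) - 1"
    unfolding card_lang_Suc card_vertex_lang Suc
    using sum_card_edge_lang[of n] by (simp flip: of_nat_sum)
  also have "\<dots> = int ((Suc n)^2 + Suc n + 1)" by (simp add: power2_eq_square)
  finally show ?case by linarith
qed

subsection \<open>From the billiard to the progressions\<close>

text \<open>States with a later tie lie in countably many hyperplanes, a null set. A finite word can
  therefore be realised by a state whose orbit continues forever.\<close>

lemma generic_dense:
  assumes "open U" "U \<noteq> {}"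
  obtains z where "z \<in> U" "generic z"
proof -
  define H where "H p = (case p of (i, j, m, l) \<Rightarrow>
    {z :: real^3. inner (axis i 1 - axis j 1) z = of_nat (Suc l) * a$j - of_nat (Suc m) * a$i})"
    for p :: "3 \<times> 3 \<times> nat \<times> nat"
  let ?I = "SIGMA i:(UNIV :: 3 set). SIGMA j:-{i}. (UNIV :: (nat \<times> nat) set)"
  have "negligible (\<Union>p\<in>?I. H p)"
  proof (rule negligible_countable_Union)
    have "countable ?I" by (intro countable_SIGMA) (simp_all add: countable_finite)
    then show "countable (H ` ?I)" by (rule countable_image)
    fix A assume "A \<in> H ` ?I"
    then obtain p where A: "A = H p" and "p \<in> ?I" by blast
    from \<open>p \<in> ?I\<close> obtain i j m l where p: "p = (i, j, m, l)" "i \<noteq> j" by auto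
    then have "(axis i 1 - axis j 1 :: real^3) $ i \<noteq> 0" by (simp add: axis_def)
    then have "axis i 1 - axis j 1 \<noteq> (0 :: real^3)" by (metis zero_index)
    then show "negligible A" unfolding A H_def p by (simp add: negligible_hyperplane)
  qed
  then have "\<not> U \<subseteq> (\<Union>p\<in>?I. H p)"
    using open_not_negligible[OF assms] negligible_subset by blast
  then obtain z where z: "z \<in> U" "\<And>p. p \<in> ?I \<Longrightarrow> z \<notin> H p" by blast
  have "generic z" unfolding generic_def
  proof (intro allI impI)
    fix i j :: 3 and m l :: nat
    assume "i \<noteq> j"
    then have "z \<notin> H (i, j, m, l)" by (intro z(2)) auto
    then show "z$i + of_nat (Suc m) * a$i \<noteq> z$j + of_nat (Suc l) * a$j"
      by (simp add: H_def inner_diff_left inner_axis' algebra_simps)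
  qed
  with z(1) show ?thesis using that by blast
qed

text \<open>
  At time 0 a point of the cube with velocity \<open>v\<close> has \<open>j\<close>-th coordinate \<open>position v z $ j\<close> if \<open>z $ j \<le> 0\<close>
  is the last time at which it was, or going straight back would have been, on a face with letter \<open>j\<close>.
\<close>

definition position :: "real^3 \<Rightarrow> real^3 \<Rightarrow> real^3" where
  "position v z = (\<chi> j. (if 0 < v$j then 0 else 1) - z$j * v$j)"

text \<open>\<open>a$j\<close> is the time needed to cross the unit cube along axis
  \<open>j\<close>. Signs are left free so that reflections preserve the property.\<close>

definition admissible :: "real^3 \<Rightarrow> bool" where
  "admissible v \<longleftrightarrow> (\<forall>j. \<bar>v$j\<bar> * a$j = 1)"

text \<open>The bound 0 is included because right after a collision the last event is the present
  one; \<open>- a$j\<close> is excluded because the point would be about to leave the cube.\<close>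

definition valid :: "real^3 \<Rightarrow> bool" where
  "valid z \<longleftrightarrow> (\<forall>j. - a$j < z$j \<and> z$j \<le> 0)"

text \<open>After the event the clock is reset, so that the collision happens at time 0.\<close>

definition step :: "3 \<Rightarrow> real^3 \<Rightarrow> real^3" where
  "step i z = advance i z + vec (- (z$i + a$i))"

lemma step_nth: "step i z $ j = (if j = i then 0 else z$j - (z$i + a$i))"
  by (simp add: step_def advance_nth)

lemma admissible_nth:
  assumes "admissible v"
  shows "v$j = 1 / a$j \<or> v$j = - 1 / a$j" "v$j \<noteq> 0"
proof -
  have "\<bar>v$j\<bar> * a$j = 1" using assms by (simp add: admissible_def)
  then show "v$j = 1 / a$j \<or> v$j = - 1 / a$j" "v$j \<noteq> 0"
    using pos[of j] by (auto simp: field_simps abs_if split: if_splits)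
qed

lemma position_nth:
  assumes "admissible v"
  shows "position v z $ j = - z$j / a$j \<or> position v z $ j = 1 + z$j / a$j"
  using admissible_nth(1)[OF assms, of j] pos[of j]
  by (auto simp: position_def)

lemma position_bounds:
  assumes "admissible v"
  shows "0 < position v z $ j \<and> position v z $ j < 1 \<longleftrightarrow> - a$j < z$j \<and> z$j < 0"
    and "0 \<le> position v z $ j \<and> position v z $ j \<le> 1 \<longleftrightarrow> - a$j \<le> z$j \<and> z$j \<le> 0"
    and "position v z $ j = 0 \<or> position v z $ j = 1 \<longleftrightarrow> z$j = - a$j \<or> z$j = 0"
  by (rule disjE[OF position_nth[OF assms, of z j]]; simp only:;
      use pos[of j] in \<open>auto simp: field_simps\<close>)+

lemma position_inj:
  assumes "admissible v" "position v z = position v y"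
  shows "z = y"
  using assms(2) admissible_nth(2)[OF assms(1)]
  by (simp add: position_def vec_eq_iff)

lemma position_surj:
  assumes "admissible v"
  obtains z where "x = position v z"
  using that[of "\<chi> j. ((if 0 < v$j then 0 else 1) - x$j) / v$j"] admissible_nth(2)[OF assms]
  by (simp add: position_def vec_eq_iff)

lemma position_move: "position v z + t *\<^sub>R v = position v (z + vec (- t))"
  by (simp add: position_def vec_eq_iff algebra_simps)

lemma admissible_reflect: "admissible v \<Longrightarrow> admissible (reflect i v)"
  by (auto simp: admissible_def reflect_def)

text \<open>Reversing velocity \<open>i\<close> exchanges the face being reached with the face being
  left: the same point is described by a last event \<open>i\<close> at time 0 instead of
  \<open>- a$i\<close>.\<close>

lemma position_reflect:
  assumes "admissible v"
  shows "position (reflect i v) (step i z) = position v (z + vec (- (z$i + a$i)))"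
proof -
  have "position (reflect i v) (step i z) $ j = position v (z + vec (- (z$i + a$i))) $ j" for j
    using admissible_nth(1)[OF assms, of j] pos[of j]
    by (cases "j = i") (auto simp: position_def reflect_def step_nth)
  then show ?thesis by (simp add: vec_eq_iff)
qed

section \<open>Collisions with the faces of the cube\<close>

lemma mem_unit_cube: "x \<in> unit_cube \<longleftrightarrow> (\<forall>j. 0 \<le> x$j \<and> x$j \<le> 1)"
  by (simp add: unit_cube_def mem_box_cart)

lemma mem_interior_unit_cube: "x \<in> interior unit_cube \<longleftrightarrow> (\<forall>j. 0 < x$j \<and> x$j < 1)"
  by (simp add: unit_cube_def mem_box_cart)

lemma mem_cube_faces:
  "x \<in> cube_face i 0 \<union> cube_face i 1 \<longleftrightarrow> x \<in> unit_cube \<and> (x$i = 0 \<or> x$i = 1)"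
  by (auto simp: cube_face_def)

lemma mem_cube_faces_minus_edges:
  "x \<in> (cube_face i 0 \<union> cube_face i 1) - cube_edges \<longleftrightarrow>
     x \<in> unit_cube \<and> (\<forall>j. (x$j = 0 \<or> x$j = 1) \<longleftrightarrow> j = i)"
proof -
  have "P i \<and> \<not> (\<exists>i j. i \<noteq> j \<and> P i \<and> P j) \<longleftrightarrow> (\<forall>j. P j \<longleftrightarrow> j = i)" for P :: "3 \<Rightarrow> bool"
    by metis
  from this[of "\<lambda>j. x$j = 0 \<or> x$j = 1"] show ?thesis
    unfolding cube_edges_def Diff_iff mem_cube_faces mem_Collect_eq Int_iff by blast
qed

text \<open>The collision comes after time \<open>z$i + a$i\<close>. Avoiding edges means that the
  other coordinates have not yet reached their faces, which is the strict inequality in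
  \<open>first\<close>.\<close>

lemma hits_face_iff:
  assumes v: "admissible v" and z: "valid z"
  shows "hits_face (position v z) v y i \<longleftrightarrow> first i z \<and> y = position (reflect i v) (step i z)"
proof
  assume "hits_face (position v z) v y i"
  then obtain t where t: "t > 0" and y: "y = position v (z + vec (- t))"
    and f: "y \<in> (cube_face i 0 \<union> cube_face i 1) - cube_edges"
    unfolding hits_face_def position_move by blast
  have cube: "- a$j \<le> z$j - t" for j
    using f position_bounds(2)[OF v, of "z + vec (- t)" j]
    unfolding mem_cube_faces_minus_edges mem_unit_cube y by simp
  have face: "z$j - t = - a$j \<or> z$j - t = 0 \<longleftrightarrow> j = i" for j
    using f position_bounds(3)[OF v, of "z + vec (- t)" j]
    unfolding mem_cube_faces_minus_edges y by simp
  \<comment> \<open>Since \<open>t > 0\<close> and \<open>z$i \<le> 0\<close>, the face behind the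
    point is ruled out.\<close>
  have t_eq: "t = z$i + a$i" using face[of i] t z[unfolded valid_def, THEN spec, of i] by auto
  have "first i z" unfolding first_def
  proof (intro allI impI)
    fix j assume "j \<noteq> i"
    then show "z$i + a$i < z$j + a$j" using cube[of j] face[of j] t_eq by auto
  qed
  then show "first i z \<and> y = position (reflect i v) (step i z)"
    using y t_eq position_reflect[OF v] by simp
next
  assume *: "first i z \<and> y = position (reflect i v) (step i z)"
  define t where "t = z$i + a$i"
  have y: "y = position v (z + vec (- t))" using * position_reflect[OF v] by (simp add: t_def)
  have t: "t > 0" using z[unfolded valid_def, THEN spec, of i] by (simp add: t_def)
  have lt: "t < z$j + a$j" if "j \<noteq> i" for j using * that by (simp add: t_def first_def)
  have le: "t \<le> z$j + a$j" for j using lt[of j] by (cases "j = i") (auto simp: t_def)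
  have z0: "z$j \<le> 0" for j using z by (simp add: valid_def)
  show "hits_face (position v z) v y i"
    unfolding hits_face_def
  proof (intro conjI exI[of _ t] subsetI)
    show "y = position v z + t *\<^sub>R v" by (simp add: y position_move)
    have "position v (z + vec (- t)) $ j = 0 \<or> position v (z + vec (- t)) $ j = 1 \<longleftrightarrow> j = i" for j
      unfolding position_bounds(3)[OF v] using t z0[of j] lt[of j] by (cases "j = i") (auto simp: t_def)
    moreover have "y \<in> unit_cube"
      unfolding mem_unit_cube y position_bounds(2)[OF v]
      using le z0 t by (auto simp: algebra_simps intro: order_trans[of _ 0])
    ultimately show "y \<in> (cube_face i 0 \<union> cube_face i 1) - cube_edges"
      unfolding mem_cube_faces_minus_edges using y by blast
    fix x assume "x \<in> open_segment (position v z) y"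
    then obtain u where u: "0 < u" "u < 1" "x = (1 - u) *\<^sub>R position v z + u *\<^sub>R y"
      by (auto simp: in_segment)
    then have "x = position v z + (u * t) *\<^sub>R v"
      unfolding y position_move[symmetric] by (simp add: algebra_simps)
    then have x: "x = position v (z + vec (- (u * t)))" by (simp add: position_move)
    have "0 < u * t" "u * t < t" using u t by auto
    then show "x \<in> interior unit_cube"
      unfolding mem_interior_unit_cube x position_bounds(1)[OF v]
      using le z0 by (auto simp: algebra_simps) (smt (verit))+
  qed (fact t)
qed

lemma valid_step: "valid z \<Longrightarrow> first i z \<Longrightarrow> valid (step i z)"
  unfolding valid_def step_nth first_def using pos by (smt (verit))

lemma valid_fresh: "valid z \<Longrightarrow> fresh z"
  unfolding valid_def fresh_def by (smt (verit))

lemma codes_step: "codes w (step i z) \<longleftrightarrow> codes w (advance i z)"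
  unfolding step_def codes_shift ..

lemma generic_shift: "generic (z + vec c) \<longleftrightarrow> generic z"
  by (simp add: generic_def)

lemma generic_step: "generic z \<Longrightarrow> generic (step i z)"
  using generic_run[of z "[i]"] by (simp add: step_def generic_shift run_Cons)

lemma billiard_coding_iff:
  assumes \<omega>: "admissible (sgn \<omega>)"
  shows "billiard_coding \<omega> l \<longleftrightarrow>
    (\<exists>Z. (\<forall>j. - a$j < Z 0 $ j \<and> Z 0 $ j < 0) \<and>
       (\<forall>k. first (l k) (Z k) \<and> Z (Suc k) = step (l k) (Z k)))"
proof
  assume "billiard_coding \<omega> l"
  then obtain q v where q0: "q 0 \<in> interior unit_cube" and v0: "v 0 = sgn \<omega>"
    and hit: "\<And>k. hits_face (q k) (v k) (q (Suc k)) (l k)" and v: "\<And>k. v (Suc k) = reflect (l k) (v k)"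
    unfolding billiard_coding_def by blast
  have adm: "admissible (v k)" for k
    by (induction k) (simp_all add: v0 v \<omega> admissible_reflect)
  then have "\<forall>k. \<exists>z. q k = position (v k) z" by (metis position_surj)
  then obtain Z where Z: "\<And>k. q k = position (v k) (Z k)" by metis
  have Z0: "- a$j < Z 0 $ j \<and> Z 0 $ j < 0" for j
    using q0 position_bounds(1)[OF adm[of 0], of "Z 0" j] by (simp add: Z mem_interior_unit_cube)
  have next_state: "first (l k) (Z k) \<and> Z (Suc k) = step (l k) (Z k)" if "valid (Z k)" for k
  proof -
    have *: "first (l k) (Z k)" "q (Suc k) = position (v (Suc k)) (step (l k) (Z k))"
      using hit[of k] hits_face_iff[OF adm that] by (simp_all add: Z v)
    then show ?thesis using position_inj[OF adm[of "Suc k"]] Z by metis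
  qed
  have "valid (Z k)" for k
  proof (induction k)
    case 0
    show ?case using Z0 by (simp add: valid_def less_imp_le)
  next
    case (Suc k)
    then show ?case using next_state[of k] valid_step by metis
  qed
  then show "\<exists>Z. (\<forall>j. - a$j < Z 0 $ j \<and> Z 0 $ j < 0) \<and>
      (\<forall>k. first (l k) (Z k) \<and> Z (Suc k) = step (l k) (Z k))"
    using Z0 next_state by blast
next
  assume "\<exists>Z. (\<forall>j. - a$j < Z 0 $ j \<and> Z 0 $ j < 0) \<and>
    (\<forall>k. first (l k) (Z k) \<and> Z (Suc k) = step (l k) (Z k))"
  then obtain Z where Z0: "\<And>j. - a$j < Z 0 $ j \<and> Z 0 $ j < 0"
    and first: "\<And>k. first (l k) (Z k)" and Z: "\<And>k. Z (Suc k) = step (l k) (Z k)" by blast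
  define v where "v = rec_nat (sgn \<omega>) (\<lambda>k. reflect (l k))"
  have v: "v 0 = sgn \<omega>" "\<And>k. v (Suc k) = reflect (l k) (v k)" by (simp_all add: v_def)
  have adm: "admissible (v k)" for k
    by (induction k) (simp_all add: v \<omega> admissible_reflect)
  have valid: "valid (Z k)" for k
  proof (induction k)
    case 0
    show ?case using Z0 by (simp add: valid_def less_imp_le)
  qed (simp add: Z first valid_step)
  show "billiard_coding \<omega> l" unfolding billiard_coding_def
  proof (intro exI conjI allI)
    show "position (v 0) (Z 0) \<in> interior unit_cube"
      unfolding mem_interior_unit_cube position_bounds(1)[OF adm] using Z0 by blast
    show "v 0 = sgn \<omega>" by (fact v)
    show "v (Suc k) = reflect (l k) (v k)" for k by (fact v)
    show "hits_face (position (v k) (Z k)) (v k) (position (v (Suc k)) (Z (Suc k))) (l k)" for k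
      unfolding hits_face_iff[OF adm valid] v Z using first by blast
  qed
qed

lemma codes_orbit:
  assumes "\<And>k. first (l k) (Z k)" "\<And>k. Z (Suc k) = step (l k) (Z k)"
  shows "codes (map l [k..<k + n]) (Z k)"
proof (induction n arbitrary: k)
  case (Suc n)
  have "[k..<k + Suc n] = k # [Suc k..<Suc k + n]" by (simp add: upt_conv_Cons)
  moreover have "codes (map l [Suc k..<Suc k + n]) (advance (l k) (Z k))"
    using Suc[of "Suc k"] unfolding assms(2) codes_step .
  ultimately show ?case using assms(1)[of k] by simp
qed simp

text \<open>States of an orbit are fresh. Conversely, the fresh states coding \<open>u\<close> form
  an open set, which contains a generic state; following its first letters gives an infinite orbit
  that begins with \<open>u\<close>.\<close>

lemma billiard_language_eq:
  assumes \<omega>: "admissible (sgn \<omega>)"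
  shows "billiard_language n \<omega> = lang n"
proof
  show "billiard_language n \<omega> \<subseteq> lang n"
  proof
    fix u assume "u \<in> billiard_language n \<omega>"
    then obtain l k where u: "u = map l [k..<k + n]" and "billiard_coding \<omega> l"
      unfolding billiard_language_def by blast
    then obtain Z where Z0: "\<And>j. - a$j < Z 0 $ j \<and> Z 0 $ j < 0"
      and first: "\<And>k. first (l k) (Z k)" and Z: "\<And>k. Z (Suc k) = step (l k) (Z k)"
      unfolding billiard_coding_iff[OF \<omega>] by blast
    have "valid (Z k)" for k
    proof (induction k)
      case 0
      show ?case using Z0 by (simp add: valid_def less_imp_le)
    qed (simp add: Z first valid_step)
    then show "u \<in> lang n"
      using codes_orbit[of l Z k n] first Z valid_fresh[of "Z k"]
      by (auto simp: lang_def u intro!: exI[of _ "Z k"])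
  qed
next
  show "lang n \<subseteq> billiard_language n \<omega>"
  proof
    fix u assume "u \<in> lang n"
    then have len: "length u = n" and "{z. fresh z} \<inter> {z. codes u z} \<noteq> {}" by (auto simp: lang_def)
    then obtain y where y: "fresh y" "codes u y" "generic y"
      using generic_dense[of "{z. fresh z} \<inter> {z. codes u z}"] open_fresh open_codes by auto
    \<comment> \<open>At an instant between all last and all next events the point is in the
      interior of the cube, as an initial position must be.\<close>
    obtain c where c: "\<And>j. y$j < c \<and> c < y$j + a$j"
    proof -
      have "Max (range (($) y)) < Min (range (\<lambda>j. y$j + a$j))"
        using y(1) by (auto simp: fresh_def)
      then obtain c where "Max (range (($) y)) < c" "c < Min (range (\<lambda>j. y$j + a$j))"
        using dense by blast
      then have "\<And>j. y$j < c \<and> c < y$j + a$j" by simp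
      then show ?thesis using that by blast
    qed
    define z where "z = y + vec (- c)"
    have z: "codes u z" "generic z" "\<And>j. - a$j < z$j \<and> z$j < 0"
      unfolding z_def codes_shift generic_shift using y c by (auto simp: algebra_simps)
    define letter where "letter z = (SOME i. first i z)" for z
    define Z where "Z k = ((\<lambda>z. step (letter z) z) ^^ k) z" for k
    have Z: "Z 0 = z" "\<And>k. Z (Suc k) = step (letter (Z k)) (Z k)" by (simp_all add: Z_def)
    have "generic (Z k)" for k by (induction k) (simp_all add: Z z generic_step)
    then have first: "first (letter (Z k)) (Z k)" for k
      unfolding letter_def by (meson generic_first someI_ex)
    have "billiard_coding \<omega> (\<lambda>k. letter (Z k))"
      unfolding billiard_coding_iff[OF \<omega>] using z(3) Z first by (intro exI[of _ Z]) auto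
    moreover have "u = map (\<lambda>k. letter (Z k)) [0..<0 + n]"
      using codes_orbit[of "\<lambda>k. letter (Z k)" Z 0 n] first Z z(1) len
      by (intro codes_unique[of u z]) (simp_all add: Z(1) del: upt_Suc)
    ultimately show "u \<in> billiard_language n \<omega>" unfolding billiard_language_def by blast
  qed
qed

end

section \<open>Periods of a B irrational direction\<close>

lemma rationally_independent_nonzero:
  assumes "rationally_independent x"
  shows "x$i \<noteq> 0"
proof
  define r :: "3 \<Rightarrow> rat" where "r j = of_bool (j = i)" for j
  assume "x$i = 0"
  then have "(\<Sum>j\<in>UNIV. of_rat (r j) * x$j) = 0"
    by (intro sum.neutral) (simp add: r_def)
  then have "r i = 0" using assms unfolding rationally_independent_def by blast
  then show False by (simp add: r_def)
qed

theorem theorem6: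
  fixes \<omega> :: "real^3" and n :: nat
  assumes "B_irrational \<omega>" and "n > 0"
  shows "billiard_complexity n \<omega> = n^2 + n + 1"
proof -
  define a :: "real^3" where "a = (\<chi> i. norm \<omega> / \<bar>\<omega>$i\<bar>)"
  have ind: "rationally_independent (\<chi> i. inverse (\<omega>$i))"
    using assms(1) by (simp add: B_irrational_def)
  have nz: "\<omega>$i \<noteq> 0" for i
    using rationally_independent_nonzero[OF ind, of i] by simp
  then have norm: "norm \<omega> > 0" by (metis zero_index zero_less_norm_iff)
  interpret three_periods a
  proof
    show "0 < a$i" for i using nz[of i] norm by (simp add: a_def)
    fix m :: "3 \<Rightarrow> int" and i
    \<comment> \<open>The periods involve absolute values; the signs of the components of
      \<open>\<omega>\<close> are moved into the rational coefficients.\<close>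
    define r :: "3 \<Rightarrow> rat" where "r j = of_int (m j) * (if \<omega>$j > 0 then 1 else - 1)" for j
    assume "(\<Sum>j\<in>UNIV. of_int (m j) * a$j) = 0"
    moreover have "of_int (m j) * a$j = norm \<omega> * (of_rat (r j) * (\<chi> i. inverse (\<omega>$i)) $ j)" for j
      using nz[of j] by (simp add: a_def r_def of_rat_mult of_rat_minus field_simps)
    ultimately have "(\<Sum>j\<in>UNIV. of_rat (r j) * (\<chi> i. inverse (\<omega>$i)) $ j) = 0"
      using norm by (simp flip: sum_distrib_left)
    then have "r i = 0" using ind unfolding rationally_independent_def by blast
    then show "m i = 0" by (simp add: r_def split: if_splits)
  qed
  have "admissible (sgn \<omega>)"
    using nz norm unfolding admissible_def by (simp add: a_def sgn_div_norm abs_mult)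
  then show ?thesis
    by (simp add: billiard_complexity_def billiard_language_eq card_lang)
qed

end
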